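(* Let $k_1,k_2,k_3$ be positive integers and $\vec{k}=(k_1,k_2,k_3)$. Then the $q,t$-Catalan number $C_{\vec{k}}(q,t)$ is $q,t$-symmetric, i.e. $C_{\vec{k}}(q,t)=C_{\vec{k}}(t,q)$ as polynomials in $q,t$.
   Context: For a vector $\vec{k}=(k_1,k_2,k_3)$ of positive integers, a $\vec{k}$-Dyck path is a lattice path starting and ending at level $0$ and never going below level $0$, consisting of three red up steps of heights $k_1,k_2,k_3$ (in this order, the first being the first step of the path) and $k_1+k_2+k_3$ blue down steps of height $1$. The red ranks $(r_1,r_2,r_3)$ of the path are the levels at which the three red steps start, so $r_1=0$. The set $\mathcal{D}_{\vec{k}}$ of $\vec{k}$-Dyck paths is in bijection, via red ranks, with the set of integer pairs $(r_2,r_3)$ such that $0\le r_2\le k_1$ and $0\le r_3\le r_2+k_2$. For $D\in\mathcal{D}_{\vec{k}}$ with red ranks $(0,r_2,r_3)$, the statistics area and bounce are $$\mathrm{area}(D)=r_2+r_3,$$ $$\mathrm{bounce}(D)=\begin{cases}2(k_1-r_2)+r_2+k_2-r_3-\min(r_2,k_2), & \text{if } r_2+k_2-r_3\ge 2\min(r_2,k_2),\\[2pt] 2(k_1-r_2)+\left\lceil \frac{r_2+k_2-r_3}{2}\right\rceil, & \text{otherwise.}\end{cases}$$ The generalized $q,t$-Catalan number is $$C_{\vec{k}}(q,t)=\sum_{D\in\mathcal{D}_{\vec{k}}}q^{\mathrm{area}(D)}t^{\mathrm{bounce}(D)}.$$ *)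

theory Defs
  imports Complex_Main "HOL-Computational_Algebra.Polynomial"
begin

text \<open>A red step carries its height; a blue step goes down by 1.\<close>

datatype step = Red nat | Blue

fun rise :: "step \<Rightarrow> int" where
  "rise (Red k) = int k"
| "rise Blue = -1"

definition is_red :: "step \<Rightarrow> bool" where
  "is_red s \<longleftrightarrow> (\<exists>k. s = Red k)"

text \<open>Level reached after the first \<open>i\<close> steps, i.e. the level at which step number \<open>i\<close>
  (counting from 0) starts.\<close>

definition level :: "step list \<Rightarrow> nat \<Rightarrow> int" where
  "level w i = (\<Sum>s\<leftarrow>take i w. rise s)"

definition dyck_path :: "nat list \<Rightarrow> step list \<Rightarrow> bool" where
  "dyck_path ks w \<longleftrightarrow>
     filter is_red w = map Red ks \<and>
     w \<noteq> [] \<and> is_red (hd w) \<and>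
     count_list w Blue = sum_list ks \<and>
     (\<forall>i\<le>length w. 0 \<le> level w i) \<and>
     level w (length w) = 0"

definition red_ranks :: "step list \<Rightarrow> int list" where
  "red_ranks w = map (level w) (filter (\<lambda>i. is_red (w ! i)) [0..<length w])"

definition dyck_paths :: "nat \<Rightarrow> nat \<Rightarrow> nat \<Rightarrow> step list set" where
  "dyck_paths k1 k2 k3 = {w. dyck_path [k1, k2, k3] w}"

text \<open>List positions count from 0, so the ranks \<open>(r\<^sub>1, r\<^sub>2, r\<^sub>3)\<close> are the entries 0, 1, 2.\<close>

definition area :: "step list \<Rightarrow> int" where
  "area w = (let r2 = red_ranks w ! 1; r3 = red_ranks w ! 2 in r2 + r3)"

definition bounce :: "nat \<Rightarrow> nat \<Rightarrow> step list \<Rightarrow> int" where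
  "bounce k1 k2 w =
     (let r2 = red_ranks w ! 1; r3 = red_ranks w ! 2 in
      if r2 + int k2 - r3 \<ge> 2 * min r2 (int k2)
      then 2 * (int k1 - r2) + r2 + int k2 - r3 - min r2 (int k2)
      else 2 * (int k1 - r2) + \<lceil>real_of_int (r2 + int k2 - r3) / 2\<rceil>)"

text \<open>The sum is written for arbitrary arguments \<open>q\<close> and \<open>t\<close>, so that the two indeterminates can be
  substituted in either order. The index set is finite (\<open>finite_dyck_paths\<close> below) and both
  exponents are nonnegative on it (\<open>area_nonneg\<close>, \<open>bounce_nonneg\<close>), so \<open>nat\<close> does not truncate.\<close>

definition qt_catalan :: "nat \<Rightarrow> nat \<Rightarrow> nat \<Rightarrow> 'a::comm_semiring_1 \<Rightarrow> 'a \<Rightarrow> 'a" where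
  "qt_catalan k1 k2 k3 q t =
     (\<Sum>w\<in>dyck_paths k1 k2 k3. q ^ nat (area w) * t ^ nat (bounce k1 k2 w))"

text \<open>The indeterminates of the bivariate polynomial ring \<open>\<int>[q][t]\<close>.\<close>

definition q_var :: "int poly poly" where
  "q_var = [:[:0, 1:]:]"

definition t_var :: "int poly poly" where
  "t_var = [:0, 1:]"


subsection \<open>Paths and their red ranks\<close>

lemma is_red_simps [simp]: "is_red (Red k)" "\<not> is_red Blue"
  by (auto simp: is_red_def)

lemma not_red [simp]: "\<not> is_red s \<longleftrightarrow> s = Blue"
  by (cases s) auto

definition mk_path :: "nat \<Rightarrow> nat \<Rightarrow> nat \<Rightarrow> nat \<Rightarrow> nat \<Rightarrow> nat \<Rightarrow> step list" where
  "mk_path k1 k2 k3 a b c =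
     Red k1 # replicate a Blue @ Red k2 # replicate b Blue @ Red k3 # replicate c Blue"

definition nonneg_from :: "int \<Rightarrow> step list \<Rightarrow> bool" where
  "nonneg_from h w \<longleftrightarrow> (\<forall>i\<le>length w. 0 \<le> h + level w i)"

lemma level_0 [simp]: "level w 0 = 0" "level [] i = 0"
  by (auto simp: level_def)

lemma level_Cons_Suc [simp]: "level (s # w) (Suc i) = rise s + level w i"
  by (simp add: level_def)

lemma nonneg_from_Nil [simp]: "nonneg_from h [] \<longleftrightarrow> 0 \<le> h"
  by (simp add: nonneg_from_def)

lemma nonneg_from_Cons [simp]:
  "nonneg_from h (s # w) \<longleftrightarrow> 0 \<le> h \<and> nonneg_from (h + rise s) w"
proof -
  have "(\<forall>i\<le>Suc n. P i) \<longleftrightarrow> P 0 \<and> (\<forall>i\<le>n. P (Suc i))" for n and P :: "nat \<Rightarrow> bool"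
    by (metis Suc_le_mono le0 not0_implies_Suc)
  from this[of "length w" "\<lambda>i. 0 \<le> h + level (s # w) i"] show ?thesis
    by (simp add: nonneg_from_def add.assoc)
qed

lemma nonneg_from_replicate:
  "nonneg_from h (replicate n Blue @ w) \<longleftrightarrow> (n = 0 \<or> int n \<le> h) \<and> nonneg_from (h - int n) w"
proof (induction n arbitrary: h)
  case (Suc n)
  have "nonneg_from g w \<Longrightarrow> 0 \<le> g" for g
    by (auto simp: nonneg_from_def)
  from this[of "h - 1 - int n"] Suc[of "h - 1"] show ?case
    by (auto simp: algebra_simps)
qed simp

lemma red_ranks_Nil [simp]: "red_ranks [] = []"
  by (simp add: red_ranks_def)

lemma red_ranks_Cons:
  "red_ranks (s # w) = (if is_red s then [0] else []) @ map ((+) (rise s)) (red_ranks w)"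
proof -
  have "[0..<length (s # w)] = 0 # map Suc [0..<length w]"
    by (simp add: map_Suc_upt upt_conv_Cons del: upt_Suc)
  then show ?thesis
    by (simp add: red_ranks_def filter_map o_def)
qed

lemma red_ranks_replicate:
  "red_ranks (replicate n Blue @ w) = map (\<lambda>x. x - int n) (red_ranks w)"
  by (induction n) (simp_all add: red_ranks_Cons o_def algebra_simps)

lemma red_ranks_mk_path:
  "red_ranks (mk_path k1 k2 k3 a b c) = [0, int k1 - int a, int k1 - int a + int k2 - int b]"
  using red_ranks_replicate[of c "[]"]
  by (simp add: mk_path_def red_ranks_Cons red_ranks_replicate o_def)

lemma level_length: "level w (length w) = (\<Sum>s\<leftarrow>w. rise s)"
  by (simp add: level_def)

lemma red_split:
  assumes "filter is_red w = Red k # v"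
  obtains n w' where "w = replicate n Blue @ Red k # w'" "filter is_red w' = v"
proof -
  from assms obtain us vs where "w = us @ Red k # vs" "\<forall>u\<in>set us. \<not> is_red u" "v = filter is_red vs"
    by (auto simp: filter_eq_Cons_iff)
  moreover from this have "us = replicate (length us) Blue"
    by (simp add: replicate_eqI)
  ultimately show thesis
    using that by metis
qed

lemma dyck_path_3_iff:
  "dyck_path [k1, k2, k3] w \<longleftrightarrow>
     (\<exists>a b. a \<le> k1 \<and> b \<le> k1 - a + k2 \<and> w = mk_path k1 k2 k3 a b (k1 + k2 + k3 - a - b))"
  (is "?L \<longleftrightarrow> ?R")
proof
  assume L: ?L
  from L have "filter is_red w = [Red k1, Red k2, Red k3]"
    by (simp add: dyck_path_def)
  then obtain z w1 where w: "w = replicate z Blue @ Red k1 # w1"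
    and f1: "filter is_red w1 = [Red k2, Red k3]" by (rule red_split)
  from f1 obtain a w2 where w1: "w1 = replicate a Blue @ Red k2 # w2"
    and f2: "filter is_red w2 = [Red k3]" by (rule red_split)
  from f2 obtain b w3 where w2: "w2 = replicate b Blue @ Red k3 # w3"
    and f3: "filter is_red w3 = []" by (rule red_split)
  from f3 have w3: "w3 = replicate (length w3) Blue"
    by (simp add: filter_empty_conv replicate_eqI)
  define c where "c = length w3"
  have z: "z = 0"
    using L w by (cases z) (auto simp: dyck_path_def)
  have eq: "w = mk_path k1 k2 k3 a b c"
    using w w1 w2 w3 z by (simp add: mk_path_def c_def)
  have "nonneg_from 0 w" "(\<Sum>s\<leftarrow>w. rise s) = 0"
    using L by (auto simp: dyck_path_def nonneg_from_def level_length)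
  then have "a \<le> k1" "b \<le> k1 - a + k2" "c = k1 + k2 + k3 - a - b"
    unfolding eq mk_path_def
    by (auto simp: nonneg_from_replicate sum_list_replicate)
  then show ?R using eq by blast
next
  assume ?R
  then obtain a b where ab: "a \<le> k1" "b \<le> k1 - a + k2"
    and w: "w = mk_path k1 k2 k3 a b (k1 + k2 + k3 - a - b)" by blast
  define c where "c = k1 + k2 + k3 - a - b"
  have c: "int c = int k1 + int k2 + int k3 - int a - int b" "a + b + c = k1 + k2 + k3"
    using ab by (simp_all add: c_def)
  have count: "count_list (replicate n Blue) Blue = n" for n
    by (induction n) auto
  have "nonneg_from 0 w"
    using ab c nonneg_from_replicate[of _ c "[]"] unfolding w mk_path_def c_def[symmetric]
    by (auto simp: nonneg_from_replicate)
  moreover have "level w (length w) = 0"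
    using c unfolding level_length w mk_path_def c_def[symmetric]
    by (simp add: sum_list_replicate)
  moreover have "filter is_red w = map Red [k1, k2, k3]" "w \<noteq> []" "is_red (hd w)"
    "count_list w Blue = sum_list [k1, k2, k3]"
    using c unfolding w mk_path_def c_def[symmetric] by (simp_all add: count)
  ultimately show ?L
    by (simp add: dyck_path_def nonneg_from_def)
qed

lemma finite_dyck_paths: "finite (dyck_paths k1 k2 k3)"
proof (rule finite_subset)
  show "dyck_paths k1 k2 k3 \<subseteq>
    (\<lambda>(a, b). mk_path k1 k2 k3 a b (k1 + k2 + k3 - a - b)) ` ({..k1} \<times> {..k1 + k2})"
    by (force simp: dyck_paths_def dyck_path_3_iff)
qed simp

text \<open>Paths correspond to the admissible pairs of ranks.\<close>

lemma bij_betw_red_ranks: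
  "bij_betw (\<lambda>w. (red_ranks w ! 1, red_ranks w ! 2)) (dyck_paths k1 k2 k3)
     {(r2, r3). 0 \<le> r2 \<and> r2 \<le> int k1 \<and> 0 \<le> r3 \<and> r3 \<le> r2 + int k2}"
  unfolding bij_betw_def
proof
  show "inj_on (\<lambda>w. (red_ranks w ! 1, red_ranks w ! 2)) (dyck_paths k1 k2 k3)"
    by (rule inj_onI) (auto simp: dyck_paths_def dyck_path_3_iff red_ranks_mk_path)
  show "(\<lambda>w. (red_ranks w ! 1, red_ranks w ! 2)) ` dyck_paths k1 k2 k3 =
    {(r2, r3). 0 \<le> r2 \<and> r2 \<le> int k1 \<and> 0 \<le> r3 \<and> r3 \<le> r2 + int k2}" (is "?f ` _ = ?S")
  proof (intro equalityI subsetI)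
    fix x assume "x \<in> ?f ` dyck_paths k1 k2 k3"
    then show "x \<in> ?S"
      by (auto simp: dyck_paths_def dyck_path_3_iff red_ranks_mk_path)
  next
    fix x assume "x \<in> ?S"
    then obtain r2 r3 where x: "x = (r2, r3)" "0 \<le> r2" "r2 \<le> int k1" "0 \<le> r3" "r3 \<le> r2 + int k2"
      by auto
    define a b where "a = nat (int k1 - r2)" and "b = nat (r2 + int k2 - r3)"
    define w where "w = mk_path k1 k2 k3 a b (k1 + k2 + k3 - a - b)"
    have "a \<le> k1" "b \<le> k1 - a + k2" "int a = int k1 - r2" "int b = r2 + int k2 - r3"
      using x by (auto simp: a_def b_def)
    then have "w \<in> dyck_paths k1 k2 k3" and "x = ?f w"
      unfolding dyck_paths_def dyck_path_3_iff
      by (blast intro: w_def, simp add: w_def red_ranks_mk_path x)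
    then show "x \<in> ?f ` dyck_paths k1 k2 k3" by blast
  qed
qed

lemma rank_bounds:
  assumes "w \<in> dyck_paths k1 k2 k3"
  shows "0 \<le> red_ranks w ! 1" "red_ranks w ! 1 \<le> int k1" "0 \<le> red_ranks w ! 2"
    "red_ranks w ! 2 \<le> red_ranks w ! 1 + int k2"
  using bij_betw_apply[OF bij_betw_red_ranks assms] by auto

lemma area_nonneg: "w \<in> dyck_paths k1 k2 k3 \<Longrightarrow> 0 \<le> area w"
  using rank_bounds[of w k1 k2 k3] by (simp add: area_def)

lemma bounce_nonneg:
  assumes "w \<in> dyck_paths k1 k2 k3"
  shows "0 \<le> bounce k1 k2 w"
proof -
  define r2 r3 where "r2 = red_ranks w ! 1" and "r3 = red_ranks w ! 2"
  note r = rank_bounds[OF assms, folded r2_def r3_def]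
  have "0 \<le> \<lceil>real_of_int (r2 + int k2 - r3) / 2\<rceil>"
    using r by (simp add: le_ceiling_iff)
  then show ?thesis
    using r unfolding bounce_def Let_def r2_def[symmetric] r3_def[symmetric] by auto
qed

end

theory Submission
  imports Defs
begin

text \<open>
  Write \<open>(x, y)\<close> for the red ranks \<open>(r\<^sub>2, r\<^sub>3)\<close>, and let the defect be
  \<open>d = min x (min k\<^sub>2 \<lfloor>(x + k\<^sub>2 - y) / 2\<rfloor>)\<close>. Both cases in the definition of bounce say that
  area + bounce is \<open>2 k\<^sub>1 + k\<^sub>2 - d\<close>, so it suffices to reflect the areas among the pairs of a
  fixed defect. If \<open>d < k\<^sub>2\<close>, each area from \<open>d\<close> to \<open>2 k\<^sub>1 + k\<^sub>2 - 2 d\<close> occurs for exactly one pair,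
  so the reflection is forced. If \<open>d = k\<^sub>2\<close>, the pairs are those with
  \<open>0 \<le> y \<le> x - k\<^sub>2\<close> and \<open>x \<le> k\<^sub>1\<close>, and \<open>(x, y) \<mapsto> (k\<^sub>1 - y, k\<^sub>1 - x)\<close> does it.
\<close>

definition rank_pairs :: "int \<Rightarrow> int \<Rightarrow> (int \<times> int) set" where
  "rank_pairs k m = {(x, y). 0 \<le> x \<and> x \<le> k \<and> 0 \<le> y \<and> y \<le> x + m}"

definition defect :: "int \<Rightarrow> int \<times> int \<Rightarrow> int" where
  "defect m = (\<lambda>(x, y). min x (min m ((x + m - y) div 2)))"

definition rank_bounce :: "int \<Rightarrow> int \<Rightarrow> int \<times> int \<Rightarrow> int" where
  "rank_bounce k m = (\<lambda>(x, y). 2 * k + m - defect m (x, y) - (x + y))"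

text \<open>For \<open>d < m\<close>, the only candidate \<open>x\<close> with defect
  \<open>d\<close> and sum \<open>a\<close>: it is \<open>d\<close> as long as
  \<open>a \<le> m\<close>; beyond that the halved term attains the minimum, forcing
  \<open>x = d + \<lceil>(a - m) / 2\<rceil>\<close>, hence the \<open>+ 1\<close>.\<close>

definition second_rank :: "int \<Rightarrow> int \<Rightarrow> int \<Rightarrow> int" where
  "second_rank m d a = d + (max 0 (a - m) + 1) div 2"

definition reflect :: "int \<Rightarrow> int \<Rightarrow> int \<times> int \<Rightarrow> int \<times> int" where
  "reflect k m = (\<lambda>(x, y).
     if defect m (x, y) = m then (k - y, k - x)
     else let b = rank_bounce k m (x, y); x' = second_rank m (defect m (x, y)) b in (x', b - x'))"

text \<open>The test in \<open>bounce\<close> fails exactly when the halved term is the strict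
  minimum in \<open>defect\<close>.\<close>

lemma bounce_eq_rank_bounce:
  "bounce k1 k2 w = rank_bounce (int k1) (int k2) (red_ranks w ! 1, red_ranks w ! 2)"
proof -
  have ceil: "\<lceil>real_of_int n / 2\<rceil> = n - n div 2" for n
    using ceiling_divide_eq_div[of n 2, where ?'a = real] by simp
  show ?thesis
    unfolding bounce_def Let_def rank_bounce_def defect_def ceil by auto
qed

lemma second_rank_unique:
  assumes "(x, y) \<in> rank_pairs k m" "defect m (x, y) < m"
  shows "x = second_rank m (defect m (x, y)) (x + y)"
  using assms unfolding rank_pairs_def defect_def second_rank_def
  by (auto simp: min_def max_def split: if_splits)

text \<open>The last bound combines \<open>2 * defect m (x, y) \<le> x + m - y\<close> with
  \<open>x \<le> k\<close>.\<close>

lemma defect_bounds: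
  assumes "(x, y) \<in> rank_pairs k m" "m \<ge> 0"
  shows "0 \<le> defect m (x, y)" "defect m (x, y) \<le> k"
    "defect m (x, y) \<le> x + y" "x + y \<le> 2 * k + m - 2 * defect m (x, y)"
  using assms unfolding rank_pairs_def defect_def by (auto simp: min_def)

lemma second_rank_exists:
  assumes "0 \<le> d" "d \<le> k" "d < m" "d \<le> a" "a \<le> 2 * k + m - 2 * d"
  defines "x \<equiv> second_rank m d a"
  shows "(x, a - x) \<in> rank_pairs k m" "defect m (x, a - x) = d"
  using assms(1-5) unfolding x_def rank_pairs_def defect_def second_rank_def
  by (auto simp: min_def max_def)

lemma defect_maximal_iff:
  "defect m (x, y) = m \<longleftrightarrow> m \<le> x \<and> y \<le> x - m"
  unfolding defect_def by (auto simp: min_def)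

lemma
  assumes p: "p \<in> rank_pairs k m" and m: "m \<ge> 0"
  shows reflect_in_rank_pairs: "reflect k m p \<in> rank_pairs k m"
    and rank_bounce_reflect: "rank_bounce k m (reflect k m p) = fst p + snd p"
    and sum_reflect: "fst (reflect k m p) + snd (reflect k m p) = rank_bounce k m p"
    and reflect_reflect: "reflect k m (reflect k m p) = p"
proof -
  obtain x y where xy: "p = (x, y)" by (cases p)
  define d where "d = defect m (x, y)"
  have "reflect k m p \<in> rank_pairs k m \<and> rank_bounce k m (reflect k m p) = fst p + snd p
    \<and> fst (reflect k m p) + snd (reflect k m p) = rank_bounce k m p
    \<and> reflect k m (reflect k m p) = p"
  proof (cases "d = m")
    case True
    \<comment> \<open>The swap keeps \<open>x - y\<close>, hence the condition
      \<open>y \<le> x - m\<close>; with \<open>k - x \<ge> 0\<close> this gives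
      \<open>m \<le> k - y\<close>.\<close>
    then have "m \<le> x" "y \<le> x - m" "defect m (k - y, k - x) = m"
      using p m xy by (auto simp: d_def defect_maximal_iff rank_pairs_def)
    then show ?thesis
      using True p m xy by (auto simp: reflect_def rank_bounce_def rank_pairs_def d_def)
  next
    case False
    then have dm: "d < m" by (auto simp: d_def defect_def)
    define b where "b = 2 * k + m - d - (x + y)"
    define x' where "x' = second_rank m d b"
    note bounds = defect_bounds[OF p[unfolded xy] m, folded d_def]
    \<comment> \<open>Sending \<open>a\<close> to \<open>2 * k + m - d - a\<close> exchanges the
      ends \<open>d\<close> and \<open>2 * k + m - 2 * d\<close> of the range of sums, so
      \<open>b\<close> lies in it too.\<close>
    have ex: "(x', b - x') \<in> rank_pairs k m" "defect m (x', b - x') = d"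
      using second_rank_exists[of d k m b] bounds dm by (auto simp: b_def x'_def)
    have rp: "rank_bounce k m (x, y) = b"
      by (simp add: rank_bounce_def d_def b_def)
    have r: "reflect k m p = (x', b - x')"
      using False rp by (simp add: xy reflect_def Let_def d_def x'_def)
    have rb: "rank_bounce k m (x', b - x') = x + y"
      unfolding rank_bounce_def by (simp add: ex(2)) (simp add: b_def)
    \<comment> \<open>The second reflection restores the sum \<open>x + y\<close> at defect
      \<open>d\<close>, and these two determine the pair.\<close>
    have "second_rank m d (x + y) = x"
      using second_rank_unique p dm by (simp add: xy d_def)
    then have "reflect k m (x', b - x') = (x, y)"
      using False ex rb by (simp add: reflect_def Let_def)
    then show ?thesis
      using ex(1) r rb rp by (simp add: xy)
  qed
  then show "reflect k m p \<in> rank_pairs k m" "rank_bounce k m (reflect k m p) = fst p + snd p"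
    "fst (reflect k m p) + snd (reflect k m p) = rank_bounce k m p"
    "reflect k m (reflect k m p) = p" by auto
qed

lemma qt_catalan_eq_sum_rank_pairs:
  "qt_catalan k1 k2 k3 q t =
     (\<Sum>p\<in>rank_pairs (int k1) (int k2).
        q ^ nat (fst p + snd p) * t ^ nat (rank_bounce (int k1) (int k2) p))"
  using sum.reindex_bij_betw[OF bij_betw_red_ranks[of k1 k2 k3],
      of "\<lambda>p. q ^ nat (fst p + snd p) * t ^ nat (rank_bounce (int k1) (int k2) p)"]
  by (simp add: qt_catalan_def area_def Let_def bounce_eq_rank_bounce rank_pairs_def)

theorem theorem1:
  fixes k1 k2 k3 :: nat
  assumes "k1 > 0" and "k2 > 0" and "k3 > 0"
  shows "qt_catalan k1 k2 k3 q_var t_var = qt_catalan k1 k2 k3 t_var q_var"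
  unfolding qt_catalan_eq_sum_rank_pairs
  by (rule sum.reindex_bij_witness
      [of _ "reflect (int k1) (int k2)" "reflect (int k1) (int k2)"])
    (simp_all add: reflect_reflect reflect_in_rank_pairs rank_bounce_reflect sum_reflect
      mult.commute)

end
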